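(* Let $\mathcal F$ be a finite reduced collection of forbidden words over $\Sigma$ with $\Sigma_{\mathcal F}$ irreducible, $\mathcal R=\{r_1(m_1),\dots,r_\ell(m_\ell)\}$ a reduced collection of repeated words, $p\ge2$ the length of the longest word in $\mathcal F\cup\mathcal R$, and $A$ the adjacency matrix associated with $\mathcal F$ and $\mathcal R$. Then $\Sigma_{\mathcal F}$ (identified with its conjugate $\Sigma_{\mathcal F}^{[p]}$) is a factor of the edge shift $\Sigma_A$ with factor map $\pi:\Sigma_A\to\Sigma_{\mathcal F}^{[p]}$; that is, $\pi$ is onto and $\pi\circ\sigma_A=\sigma\circ\pi$, where $\sigma_A$ and $\sigma$ are the left shift maps on $\Sigma_A$ and $\Sigma_{\mathcal F}^{[p]}$.
   Context: $\Sigma$ is a finite symbol set. A collection of words is reduced if for any two distinct words in it neither is a (contiguous) subword of the other. $\mathcal F$ is a finite reduced collection of words of length at least $2$; $\Sigma_{\mathcal F}\subseteq\Sigma^{\mathbb N}$ is the set of one-sided sequences containing no word of $\mathcal F$. A word is allowed if it is a subword of some sequence in $\Sigma_{\mathcal F}$; $\mathcal L_n$ is the set of allowed words of length $n$. All symbols are assumed allowed. $\Sigma_{\mathcal F}$ is irreducible: for all allowed $u,v$ there is a word $w$ with $uwv$ allowed. $\mathcal R$ is a finite reduced collection of allowed words $r_1,\dots,r_\ell$, each $r_i$ assigned an integer multiplicity $m_i\ge2$. For an allowed word $w$, $m(w)=\prod_{i}m_i^{n(w;r_i)}$, where $n(w;r_i)$ is the number of occurrences of $r_i$ as a subword of $w$;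 for $v=v_1\dots v_n$ allowed, $k(v)=m(v)/m(v_2\dots v_n)$ (the empty word has multiplicity $1$). For $X=x_1\dots x_{p-1}$, $Y=y_1\dots y_{p-1}$ in $\mathcal L_{p-1}$, $X*Y$ is defined only if $x_2\dots x_{p-1}=y_1\dots y_{p-2}$ (no condition if $p=2$), and then $X*Y=x_1\dots x_{p-1}y_{p-1}$. The adjacency matrix $A$ associated with $\mathcal F$ and $\mathcal R$ is indexed by $\mathcal L_{p-1}$, with $A_{XY}=k(X*Y)$ if $X*Y$ is defined and lies in $\mathcal L_p$, and $A_{XY}=0$ otherwise. $\mathcal G$ is the directed multigraph with vertex set $\mathcal L_{p-1}$ and edges $(X*Y)_1,\dots,(X*Y)_{k(X*Y)}$ from $X$ to $Y$ whenever $X*Y\in\mathcal L_p$; $\Sigma_A$ is the set of one-sided infinite paths of edges in $\mathcal G$. $\Sigma_{\mathcal F}^{[p]}$ is the $p$-block presentation of $\Sigma_{\mathcal F}$, the image of $\Sigma_{\mathcal F}$ under the conjugacy $x_1x_2x_3\dots\mapsto(x_1\dots x_p)(x_2\dots x_{p+1})\dots$; its symbols are the words $X*Y\in\mathcal L_p$. The map $\pi$ is $$\pi\bigl((X_1*X_2)_{i_1}(X_2*X_3)_{i_2}(X_3*X_4)_{i_3}\dots\bigr)=(X_1*X_2)(X_2*X_3)(X_3*X_4)\dots .$$ *)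

theory Defs
  imports
    "HOL-Analysis.Analysis"
    "HOL-Library.Sublist"
    "Graph_Theory.Digraph"
begin

text \<open>Words are lists and one-sided sequences are functions on \<^typ>\<open>nat\<close>. The alphabet \<open>\<Sigma>\<close> is a
  carrier set. Contiguous subwords are given by \<^const>\<open>sublist\<close>.\<close>

definition reduced_words :: "'a list set \<Rightarrow> bool" where
  "reduced_words C \<longleftrightarrow> (\<forall>u\<in>C. \<forall>v\<in>C. u \<noteq> v \<longrightarrow> \<not> sublist u v)"

definition block :: "(nat \<Rightarrow> 'a) \<Rightarrow> nat \<Rightarrow> nat \<Rightarrow> 'a list" where
  "block x n l = map x [n..<n + l]"

definition occurs_in :: "'a list \<Rightarrow> (nat \<Rightarrow> 'a) \<Rightarrow> bool" where
  "occurs_in w x \<longleftrightarrow> (\<exists>n. block x n (length w) = w)"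

definition subshift :: "'a set \<Rightarrow> 'a list set \<Rightarrow> (nat \<Rightarrow> 'a) set" where
  "subshift \<Sigma> F = {x. range x \<subseteq> \<Sigma> \<and> (\<forall>w\<in>F. \<not> occurs_in w x)}"

definition allowed :: "'a set \<Rightarrow> 'a list set \<Rightarrow> 'a list \<Rightarrow> bool" where
  "allowed \<Sigma> F w \<longleftrightarrow> (\<exists>x\<in>subshift \<Sigma> F. occurs_in w x)"

definition language :: "'a set \<Rightarrow> 'a list set \<Rightarrow> nat \<Rightarrow> 'a list set" where
  "language \<Sigma> F n = {w. length w = n \<and> allowed \<Sigma> F w}"

definition irreducible_subshift :: "'a set \<Rightarrow> 'a list set \<Rightarrow> bool" where
  "irreducible_subshift \<Sigma> F \<longleftrightarrow>
     (\<forall>u v. allowed \<Sigma> F u \<longrightarrow> allowed \<Sigma> F v \<longrightarrow> (\<exists>w. allowed \<Sigma> F (u @ w @ v)))"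

text \<open>Occurrences are counted by their starting positions inside \<open>w\<close>, so they may overlap, and
  the empty word \<open>w\<close> has multiplicity 1.\<close>

definition occurrences :: "'a list \<Rightarrow> 'a list \<Rightarrow> nat" where
  "occurrences w r = card {i. i < length w \<and> prefix r (drop i w)}"

text \<open>The collection of repeated words is a set \<open>R\<close> of words together with a function \<open>m\<close>, of which
  only the values on \<open>R\<close> matter.\<close>

definition multiplicity_word :: "'a list set \<Rightarrow> ('a list \<Rightarrow> nat) \<Rightarrow> 'a list \<Rightarrow> nat" where
  "multiplicity_word R m w = (\<Prod>r\<in>R. m r ^ occurrences w r)"

text \<open>The division below is exact; see \<open>multiplicity_word_tl_dvd\<close>.\<close>

definition k_mult :: "'a list set \<Rightarrow> ('a list \<Rightarrow> nat) \<Rightarrow> 'a list \<Rightarrow> nat" where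
  "k_mult R m v = multiplicity_word R m v div multiplicity_word R m (tl v)"

lemma occurrences_tl_le: "occurrences (tl v) r \<le> occurrences v r"
proof (cases v)
  case (Cons a u)
  have "Suc ` {i. i < length u \<and> prefix r (drop i u)}
      \<subseteq> {i. i < length v \<and> prefix r (drop i v)}"
    by (auto simp: Cons)
  then have "card (Suc ` {i. i < length u \<and> prefix r (drop i u)}) \<le> occurrences v r"
    unfolding occurrences_def by (intro card_mono) auto
  then show ?thesis
    by (simp add: occurrences_def card_image Cons)
qed simp

lemma multiplicity_word_tl_dvd: "multiplicity_word R m (tl v) dvd multiplicity_word R m v"
  unfolding multiplicity_word_def
  by (intro prod_dvd_prod le_imp_power_dvd occurrences_tl_le)

text \<open>\<open>X * Y\<close>: the partial operation is split into its domain \<open>overlap\<close> and its value \<open>star\<close>. For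
  words of length one the domain condition reads \<open>[] = []\<close>.\<close>

definition overlap :: "'a list \<Rightarrow> 'a list \<Rightarrow> bool" where
  "overlap X Y \<longleftrightarrow> tl X = butlast Y"

definition star :: "'a list \<Rightarrow> 'a list \<Rightarrow> 'a list" where
  "star X Y = X @ [last Y]"

text \<open>The matrix is indexed by \<open>language \<Sigma> F (p - 1)\<close>; only entries with both indices in this set
  are used.\<close>

definition adj_matrix ::
  "'a set \<Rightarrow> 'a list set \<Rightarrow> 'a list set \<Rightarrow> ('a list \<Rightarrow> nat) \<Rightarrow> nat \<Rightarrow> 'a list \<Rightarrow> 'a list \<Rightarrow> nat"
where
  "adj_matrix \<Sigma> F R m p X Y =
     (if overlap X Y \<and> star X Y \<in> language \<Sigma> F p then k_mult R m (star X Y) else 0)"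

text \<open>The edge \<open>(X * Y)\<^sub>i\<close> is the pair \<open>(star X Y, i)\<close>. The word \<open>X * Y\<close> determines \<open>X\<close>, its first
  \<open>p - 1\<close> letters, and \<open>Y\<close>, its last \<open>p - 1\<close> letters. By \<open>arcs_between\<close> below, the edges from \<open>X\<close> to
  \<open>Y\<close> are \<open>(X * Y)\<^sub>1, \<dots>, (X * Y)\<^sub>k\<close> with \<open>k = A\<^bsub>XY\<^esub>\<close>.\<close>

definition word_digraph ::
  "'a list set \<Rightarrow> ('a list \<Rightarrow> 'a list \<Rightarrow> nat) \<Rightarrow> ('a list, 'a list \<times> nat) pre_digraph"
where
  "word_digraph V A =
     \<lparr> verts = V,
       arcs = {(star X Y, i) | X Y i. X \<in> V \<and> Y \<in> V \<and> 1 \<le> i \<and> i \<le> A X Y},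
       tail = (\<lambda>(w, i). butlast w),
       head = (\<lambda>(w, i). tl w) \<rparr>"

definition edge_shift :: "('v, 'e) pre_digraph \<Rightarrow> (nat \<Rightarrow> 'e) set" where
  "edge_shift G = {e. (\<forall>n. e n \<in> arcs G) \<and> (\<forall>n. head G (e n) = tail G (e (Suc n)))}"

lemma arcs_between:
  fixes \<Sigma> :: "'a set" and F R :: "'a list set" and m :: "'a list \<Rightarrow> nat"
  assumes "2 \<le> p" and "X \<in> language \<Sigma> F (p - 1)" and "Y \<in> language \<Sigma> F (p - 1)"
  defines "G \<equiv> word_digraph (language \<Sigma> F (p - 1)) (adj_matrix \<Sigma> F R m p)"
  shows "{e \<in> arcs G. tail G e = X \<and> head G e = Y} =
         {(star X Y, i) | i. 1 \<le> i \<and> i \<le> adj_matrix \<Sigma> F R m p X Y}"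
proof -
  have ends: "butlast (star X' Y') = X' \<and> tl (star X' Y') = Y'"
    if "X' \<in> language \<Sigma> F (p - 1)" "Y' \<in> language \<Sigma> F (p - 1)" "overlap X' Y'" for X' Y'
  proof -
    have "X' \<noteq> []" "Y' \<noteq> []"
      using that assms(1) by (auto simp: language_def)
    then show ?thesis
      using that(3) by (simp add: star_def overlap_def)
  qed
  have ov: "overlap X' Y'" if "1 \<le> i" "i \<le> adj_matrix \<Sigma> F R m p X' Y'" for X' Y' i
    using that by (auto simp: adj_matrix_def split: if_splits)
  show ?thesis
  proof (intro set_eqI iffI)
    fix e assume "e \<in> {e \<in> arcs G. tail G e = X \<and> head G e = Y}"
    then obtain X' Y' i where e: "e = (star X' Y', i)" "X' \<in> language \<Sigma> F (p - 1)"
      "Y' \<in> language \<Sigma> F (p - 1)" "1 \<le> i" "i \<le> adj_matrix \<Sigma> F R m p X' Y'"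
      "butlast (star X' Y') = X" "tl (star X' Y') = Y"
      by (auto simp: G_def word_digraph_def)
    have "X' = X" "Y' = Y"
      using ends[OF e(2,3) ov[OF e(4,5)]] e(6,7) by simp_all
    then show "e \<in> {(star X Y, i) | i. 1 \<le> i \<and> i \<le> adj_matrix \<Sigma> F R m p X Y}"
      using e by simp
  next
    fix e assume "e \<in> {(star X Y, i) | i. 1 \<le> i \<and> i \<le> adj_matrix \<Sigma> F R m p X Y}"
    then obtain i where e: "e = (star X Y, i)" "1 \<le> i" "i \<le> adj_matrix \<Sigma> F R m p X Y"
      by blast
    then have "butlast (star X Y) = X \<and> tl (star X Y) = Y"
      using ends[OF assms(2,3) ov] by blast
    then show "e \<in> {e \<in> arcs G. tail G e = X \<and> head G e = Y}"
      using e assms(2,3) by (auto simp: G_def word_digraph_def)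
  qed
qed

definition shift :: "(nat \<Rightarrow> 'b) \<Rightarrow> nat \<Rightarrow> 'b" where
  "shift x = (\<lambda>n. x (Suc n))"

definition block_map :: "nat \<Rightarrow> (nat \<Rightarrow> 'a) \<Rightarrow> nat \<Rightarrow> 'a list" where
  "block_map p x = (\<lambda>n. block x n p)"

definition block_presentation :: "'a set \<Rightarrow> 'a list set \<Rightarrow> nat \<Rightarrow> (nat \<Rightarrow> 'a list) set" where
  "block_presentation \<Sigma> F p = block_map p ` subshift \<Sigma> F"

definition forget_index :: "(nat \<Rightarrow> 'a list \<times> nat) \<Rightarrow> nat \<Rightarrow> 'a list" where
  "forget_index e = (\<lambda>n. fst (e n))"

text \<open>Shift spaces carry the subspace topology of the product of discrete alphabets.\<close>

definition shift_topology :: "(nat \<Rightarrow> 'b) set \<Rightarrow> (nat \<Rightarrow> 'b) topology" where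
  "shift_topology X = subtopology (product_topology (\<lambda>_. discrete_topology UNIV) UNIV) X"

text \<open>The equation \<open>\<pi> ` X = Y\<close> says both that \<open>\<pi>\<close> maps \<open>X\<close> into \<open>Y\<close> and that it is onto.\<close>

definition factor_map ::
  "(nat \<Rightarrow> 'b) set \<Rightarrow> (nat \<Rightarrow> 'c) set \<Rightarrow> ((nat \<Rightarrow> 'b) \<Rightarrow> (nat \<Rightarrow> 'c)) \<Rightarrow> bool"
where
  "factor_map X Y \<pi> \<longleftrightarrow>
     continuous_map (shift_topology X) (shift_topology Y) \<pi> \<and>
     \<pi> ` X = Y \<and>
     (\<forall>x\<in>X. \<pi> (shift x) = shift (\<pi> x))"

end

theory Submission
  imports Defs
begin

text \<open>Since no word of \<open>F\<close> is longer than \<open>p\<close>, a sequence all of whose \<open>p\<close>-blocks are allowed lies in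
  the subshift. Along a path of edges the underlying words \<open>X * Y\<close> overlap in \<open>p - 1\<close> letters, so
  they are the \<open>p\<close>-blocks of the sequence of their first letters, which is therefore in the subshift.
  Conversely, multiplicities are positive, so every allowed \<open>p\<close>-block carries an edge with index 1,
  and these edges lift any point of the \<open>p\<close>-block presentation.\<close>

lemma length_block [simp]: "length (block x n l) = l"
  by (simp add: block_def)

lemma nth_block [simp]: "j < l \<Longrightarrow> block x n l ! j = x (n + j)"
  by (simp add: block_def)

lemma take_block: "l \<le> p \<Longrightarrow> take l (block x n p) = block x n l"
  by (rule nth_equalityI) auto

lemma tl_block: "tl (block x n l) = block x (Suc n) (l - 1)"
  by (rule nth_equalityI) (auto simp: nth_tl)

lemma butlast_block: "butlast (block x n l) = block x n (l - 1)"
  by (rule nth_equalityI) (auto simp: nth_butlast)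

lemma star_block: "star (block x n (Suc l)) (block x (Suc n) (Suc l)) = block x n (Suc (Suc l))"
  by (simp add: star_def block_def)

lemma allowed_block: "x \<in> subshift \<Sigma> F \<Longrightarrow> allowed \<Sigma> F (block x n l)"
  by (auto simp: allowed_def occurs_in_def)

lemma allowed_subset: "allowed \<Sigma> F w \<Longrightarrow> set w \<subseteq> \<Sigma>"
proof -
  assume "allowed \<Sigma> F w"
  then obtain x n where "range x \<subseteq> \<Sigma>" and w: "block x n (length w) = w"
    by (auto simp: allowed_def subshift_def occurs_in_def)
  moreover have "set (block x n l) \<subseteq> range x" for l
    by (auto simp: block_def)
  ultimately show ?thesis
    by (metis subset_trans)
qed

text \<open>An allowed word is read off a point of the subshift, and so is each of its prefixes.
  Prefixes are enough below, because an occurrence of \<open>f\<close> at position \<open>n\<close>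
  begins the block read at \<open>n\<close>.\<close>

lemma allowed_no_forbidden_prefix:
  assumes "allowed \<Sigma> F w" and "length f \<le> length w" and "take (length f) w = f"
  shows "f \<notin> F"
proof
  assume "f \<in> F"
  obtain y k where y: "y \<in> subshift \<Sigma> F" and w: "block y k (length w) = w"
    using assms(1) by (auto simp: allowed_def occurs_in_def)
  have "block y k (length f) = f"
    using take_block[OF assms(2), of y k] w assms(3) by simp
  then show False
    using y \<open>f \<in> F\<close> by (auto simp: subshift_def occurs_in_def)
qed

lemma subshift_if_blocks_allowed:
  assumes "\<forall>f\<in>F. length f \<le> p" and "0 < p" and "\<And>n. allowed \<Sigma> F (block x n p)"
  shows "x \<in> subshift \<Sigma> F"
proof -
  \<comment> \<open>As \<open>p\<close> is positive, \<open>x n\<close> is the first letter of the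
    block at \<open>n\<close>, whose letters all lie in \<Sigma>.\<close>
  have "x n \<in> \<Sigma>" for n
  proof -
    have "block x n p ! 0 \<in> \<Sigma>"
      using allowed_subset[OF assms(3)] assms(2) by (metis length_block nth_mem subsetD)
    then show ?thesis
      using assms(2) by simp
  qed
  moreover have "\<not> occurs_in f x" if "f \<in> F" for f
  proof
    assume "occurs_in f x"
    then obtain n where "block x n (length f) = f"
      by (auto simp: occurs_in_def)
    then show False
      using allowed_no_forbidden_prefix[OF assms(3), of f n] assms(1) that
      by (simp add: take_block)
  qed
  ultimately show ?thesis
    by (auto simp: subshift_def)
qed

text \<open>Moving one letter to the right inside a word amounts to passing to the next word, so
  letter \<open>j\<close> of \<open>w n\<close> is the first letter of
  \<open>w (n + j)\<close>.\<close>

lemma overlapping_words_eq_block_map: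
  assumes "\<And>n. length (w n) = p" and "\<And>n. tl (w n) = butlast (w (Suc n))"
  shows "w = block_map p (\<lambda>n. w n ! 0)"
proof
  fix n
  have step: "w n ! Suc j = w (Suc n) ! j" if "Suc j < p" for n j
  proof -
    have "w n ! Suc j = tl (w n) ! j"
      using that assms(1) by (simp add: nth_tl)
    also have "\<dots> = w (Suc n) ! j"
      using that assms by (simp add: nth_butlast)
    finally show ?thesis .
  qed
  have nth: "w n ! j = w (n + j) ! 0" if "j < p" for n j
    using that
  proof (induction j arbitrary: n)
    case (Suc j)
    then show ?case
      using step[of j n] Suc.IH[of "Suc n"] by simp
  qed simp
  show "w n = block_map p (\<lambda>n. w n ! 0) n"
  proof (rule nth_equalityI)
    fix j assume "j < length (w n)"
    then have "j < p"
      by (simp add: assms(1))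
    then show "w n ! j = block_map p (\<lambda>n. w n ! 0) n ! j"
      unfolding block_map_def nth_block[OF \<open>j < p\<close>] by (rule nth)
  qed (simp add: assms(1) block_map_def)
qed

text \<open>The divisor divides a positive number, hence does not exceed it, and the quotient is at
  least 1.\<close>

lemma k_mult_pos:
  assumes "\<forall>r\<in>R. 0 < m r"
  shows "0 < k_mult R m v"
proof -
  have pos: "0 < multiplicity_word R m u" for u
    using assms by (auto simp: multiplicity_word_def intro: prod_pos)
  show ?thesis
    unfolding k_mult_def
    using dvd_imp_le[OF multiplicity_word_tl_dvd pos] pos by (simp add: div_greater_zero_iff)
qed

lemma arcs_word_digraph_fst:
  assumes "a \<in> arcs (word_digraph V (adj_matrix \<Sigma> F R m p))"
  shows "fst a \<in> language \<Sigma> F p"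
proof -
  obtain X Y i where a: "a = (star X Y, i)" and "1 \<le> i" and "i \<le> adj_matrix \<Sigma> F R m p X Y"
    using assms by (auto simp: word_digraph_def)
  \<comment> \<open>A nonzero entry excludes the default branch of \<open>adj_matrix\<close>, so
    \<open>star X Y\<close> is allowed.\<close>
  then have "adj_matrix \<Sigma> F R m p X Y \<noteq> 0"
    by linarith
  then show ?thesis
    unfolding adj_matrix_def a by (metis fst_conv)
qed

lemma forget_index_edge_shift:
  assumes "\<forall>f\<in>F. length f \<le> p" and "0 < p"
    and "e \<in> edge_shift (word_digraph V (adj_matrix \<Sigma> F R m p))"
  shows "forget_index e \<in> block_presentation \<Sigma> F p"
proof -
  let ?w = "forget_index e"
  let ?x = "\<lambda>n. ?w n ! 0"
  have w: "?w n \<in> language \<Sigma> F p" for n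
    using assms(3) arcs_word_digraph_fst[of "e n" V \<Sigma> F R m p]
    by (simp add: edge_shift_def forget_index_def)
  \<comment> \<open>Heads and tails of edges are \<open>tl\<close> and \<open>butlast\<close> of
    their words, so the path condition is exactly the overlap condition.\<close>
  have "tl (?w n) = butlast (?w (Suc n))" for n
    using assms(3)
    by (auto simp: edge_shift_def word_digraph_def forget_index_def split_def)
  then have eq: "?w = block_map p ?x"
    using w by (intro overlapping_words_eq_block_map) (auto simp: language_def)
  have "allowed \<Sigma> F (block ?x n p)" for n
    using w[of n] fun_cong[OF eq, of n] by (simp add: block_map_def language_def)
  then have "?x \<in> subshift \<Sigma> F"
    using assms(1,2) subshift_if_blocks_allowed by blast
  then show ?thesis
    unfolding block_presentation_def using eq by (metis image_eqI)
qed

lemma block_presentation_lift: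
  assumes "2 \<le> p" and "\<forall>r\<in>R. 0 < m r" and "x \<in> subshift \<Sigma> F"
  shows "(\<lambda>n. (block x n p, 1))
    \<in> edge_shift (word_digraph (language \<Sigma> F (p - 1)) (adj_matrix \<Sigma> F R m p))"
proof -
  let ?A = "adj_matrix \<Sigma> F R m p"
  \<comment> \<open>Blocks of length \<open>p - 1\<close> are then visibly nonempty, so that
    \<open>last\<close> in \<open>star\<close> reads an actual letter.\<close>
  obtain l where p: "p = Suc (Suc l)"
    using assms(1) by (metis add_2_eq_Suc le_Suc_ex)
  have lang: "block x n k \<in> language \<Sigma> F k" for n k
    using allowed_block[OF assms(3)] by (simp add: language_def)
  have "(block x n p, 1) \<in> arcs (word_digraph (language \<Sigma> F (p - 1)) ?A)" for n
  proof -
    let ?X = "block x n (p - 1)" and ?Y = "block x (Suc n) (p - 1)"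
    have star: "star ?X ?Y = block x n p"
      by (simp add: p star_block)
    have "overlap ?X ?Y"
      by (simp add: overlap_def tl_block butlast_block)
    then have "1 \<le> ?A ?X ?Y"
      unfolding adj_matrix_def star using k_mult_pos[OF assms(2)] lang by (simp add: Suc_le_eq)
    then have "(star ?X ?Y, 1) \<in> arcs (word_digraph (language \<Sigma> F (p - 1)) ?A)"
      unfolding word_digraph_def using lang by auto
    then show ?thesis
      unfolding star .
  qed
  then show ?thesis
    by (simp add: edge_shift_def word_digraph_def tl_block butlast_block)
qed

text \<open>Each coordinate of the map is a projection followed by \<open>g\<close>, and every map
  between discrete spaces is continuous.\<close>

lemma continuous_map_shift_topology_pointwise:
  assumes "(\<lambda>x n. g (x n)) ` X \<subseteq> Y"
  shows "continuous_map (shift_topology X) (shift_topology Y) (\<lambda>x n. g (x n))"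
proof -
  have "continuous_map (product_topology (\<lambda>_. discrete_topology UNIV) UNIV)
      (discrete_topology UNIV) (\<lambda>x. g (x n))" for n :: nat
    using continuous_map_compose[OF continuous_map_product_projection[of n UNIV],
        of "\<lambda>_. discrete_topology UNIV" "discrete_topology UNIV" g]
    by (simp add: o_def)
  then show ?thesis
    unfolding shift_topology_def using assms
    by (auto simp: continuous_map_in_subtopology continuous_map_componentwise_UNIV
        intro: continuous_map_from_subtopology)
qed

theorem proposition7p3:
  fixes \<Sigma> :: "'a set"
    and F R :: "'a list set"
    and m :: "'a list \<Rightarrow> nat"
    and p :: nat
    and A :: "'a list \<Rightarrow> 'a list \<Rightarrow> nat"
  assumes "finite \<Sigma>"
    and "finite F" and "F \<subseteq> lists \<Sigma>" and "reduced_words F" and "\<forall>w\<in>F. 2 \<le> length w"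
    and "\<forall>a\<in>\<Sigma>. allowed \<Sigma> F [a]"
    and "irreducible_subshift \<Sigma> F"
    and "finite R" and "\<forall>r\<in>R. allowed \<Sigma> F r" and "reduced_words R" and "\<forall>r\<in>R. 2 \<le> m r"
    and "F \<union> R \<noteq> {}" and "p = Max (length ` (F \<union> R))" and "2 \<le> p"
    and "A = adj_matrix \<Sigma> F R m p"
  shows "factor_map
           (edge_shift (word_digraph (language \<Sigma> F (p - 1)) A))
           (block_presentation \<Sigma> F p)
           forget_index"
proof -
  let ?G = "word_digraph (language \<Sigma> F (p - 1)) A"
  have len: "\<forall>f\<in>F. length f \<le> p"
    using assms(2,8,13) by (auto intro: Max_ge)
  have image: "forget_index ` edge_shift ?G = block_presentation \<Sigma> F p"
  proof
    show "forget_index ` edge_shift ?G \<subseteq> block_presentation \<Sigma> F p"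
      using forget_index_edge_shift[OF len] assms(14,15) by auto
    have pos: "\<forall>r\<in>R. 0 < m r"
      using assms(11) by force
    show "block_presentation \<Sigma> F p \<subseteq> forget_index ` edge_shift ?G"
    proof
      fix y assume "y \<in> block_presentation \<Sigma> F p"
      then obtain x where x: "x \<in> subshift \<Sigma> F" and y: "y = block_map p x"
        by (auto simp: block_presentation_def)
      \<comment> \<open>The preimage takes index 1 at every position, a choice available whatever
        the multiplicities are.\<close>
      have "y = forget_index (\<lambda>n. (block x n p, 1))"
        by (simp add: y block_map_def forget_index_def)
      then show "y \<in> forget_index ` edge_shift ?G"
        using block_presentation_lift[OF assms(14) pos x] unfolding assms(15) by (rule image_eqI)
    qed
  qed
  have forget: "forget_index = (\<lambda>e n. fst (e n))"
    by (simp add: fun_eq_iff forget_index_def)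
  have "continuous_map (shift_topology (edge_shift ?G))
      (shift_topology (block_presentation \<Sigma> F p)) forget_index"
    using image unfolding forget
    by (intro continuous_map_shift_topology_pointwise) (rule equalityD1)
  \<comment> \<open>Both \<open>shift\<close> and \<open>forget_index\<close> are coordinatewise
    formulas, so they commute by unfolding.\<close>
  then show ?thesis
    using image by (simp add: factor_map_def forget_index_def shift_def)
qed

end
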